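(* Let $n \ge 1$ and let $\mathbf{x} = (x_1, x_2, \ldots, x_n)$ be an increasing (i.e. non-decreasing) sequence of real numbers. Then $\mathbf{x}$ is the mean score sequence of some random $n$-team tournament if and only if $\mathbf{x} \preceq (0,1,\ldots,n-1)$, where $\preceq$ denotes majorization.
   Context: An $n$-team tournament is a specification, for each unordered pair $\{i,j\}$ of distinct elements of $\{1,\ldots,n\}$, of which of the two teams $i,j$ beats the other (each pair plays exactly once, with no ties); there are $2^{\binom{n}{2}}$ tournaments. A random tournament is given by an arbitrary probability distribution $\mu$ on the set of all $n$-team tournaments (match results need not be independent). Its mean score sequence is $(x_1,\ldots,x_n)$, where $x_i$ is the expected number of wins of team $i$ under $\mu$. For non-decreasing real sequences $\mathbf{x} = (x_1,\ldots,x_n)$ and $\mathbf{y} = (y_1,\ldots,y_n)$, $\mathbf{x} \preceq \mathbf{y}$ ("$\mathbf{x}$ is majorized by $\mathbf{y}$") means $\sum_{i=1}^k x_i \ge \sum_{i=1}^k y_i$ for all $1 \le k \le n$, with equality for $k = n$. (Equivalently, the uniform distribution on the multiset $\mathbf{x}$ is smaller in convex order than the uniform distribution on the multiset $\mathbf{y}$.) *)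

theory Defs
  imports "HOL-Probability.Probability"
begin

(* Teams are the elements of {1..n}; (i, j) \<in> T means that team i beats team j. *)
definition tournaments :: "nat \<Rightarrow> (nat \<times> nat) set set" where
  "tournaments n =
     {T. T \<subseteq> {1..n} \<times> {1..n} \<and> irrefl T \<and>
         (\<forall>i\<in>{1..n}. \<forall>j\<in>{1..n}. i \<noteq> j \<longrightarrow> ((i, j) \<in> T \<longleftrightarrow> (j, i) \<notin> T))}"

definition wins :: "(nat \<times> nat) set \<Rightarrow> nat \<Rightarrow> nat" where
  "wins T i = card {j. (i, j) \<in> T}"

(* There are finitely many n-team tournaments, so every probability distribution on
   them is a pmf; no independence between matches is imposed. *)
definition random_tournament :: "nat \<Rightarrow> (nat \<times> nat) set pmf \<Rightarrow> bool" where
  "random_tournament n \<mu> \<longleftrightarrow> set_pmf \<mu> \<subseteq> tournaments n"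

definition mean_score :: "(nat \<times> nat) set pmf \<Rightarrow> nat \<Rightarrow> real" where
  "mean_score \<mu> i = measure_pmf.expectation \<mu> (\<lambda>T. real (wins T i))"

(* A sequence (x_1, ..., x_n) is a function on nat of which only the values on {1..n} matter. *)
definition mean_score_sequence :: "nat \<Rightarrow> (nat \<times> nat) set pmf \<Rightarrow> (nat \<Rightarrow> real) \<Rightarrow> bool" where
  "mean_score_sequence n \<mu> x \<longleftrightarrow> (\<forall>i\<in>{1..n}. x i = mean_score \<mu> i)"

(* Majorization "x is majorized by y", meant for sequences that are non-decreasing on {1..n}:
   the partial sums are then sums of the k smallest entries, hence the direction of the
   inequality. *)
definition majorized_by :: "nat \<Rightarrow> (nat \<Rightarrow> real) \<Rightarrow> (nat \<Rightarrow> real) \<Rightarrow> bool" where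
  "majorized_by n x y \<longleftrightarrow>
     (\<forall>k\<in>{1..n}. (\<Sum>i=1..k. x i) \<ge> (\<Sum>i=1..k. y i)) \<and>
     (\<Sum>i=1..n. x i) = (\<Sum>i=1..n. y i)"

end

theory Submission
  imports Defs
begin

text \<open>
  Necessity holds for each tournament separately: teams \<open>1, \<dots>, k\<close> already win
  \<open>k (k - 1) / 2\<close> matches among themselves. For sufficiency, the set of mean score sequences
  contains \<open>(0, \<dots>, n - 1)\<close> and is closed under mixing and under relabelling teams, hence under
  Robin Hood transfers between two teams. As in the Hardy--Littlewood--Polya theorem, finitely
  many transfers lead from \<open>(0, \<dots>, n - 1)\<close> to any sequence that it majorizes, each of them making
  one more entry agree with the target.
\<close>

section \<open>Counting matches in a single tournament\<close>

lemma finite_tournaments: "finite (tournaments n)"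
  by (rule finite_subset[of _ "Pow ({1..n} \<times> {1..n})"]) (auto simp: tournaments_def)

lemma tournament_finite: "T \<in> tournaments n \<Longrightarrow> finite T"
  by (rule finite_subset[of _ "{1..n} \<times> {1..n}"]) (auto simp: tournaments_def)

text \<open>\<open>T\<close>, its converse and the diagonal partition the square
  \<open>{1..n} \<times> {1..n}\<close>. The doubled form avoids division and subtraction on natural
  numbers.\<close>

lemma card_tournament:
  assumes T: "T \<in> tournaments n"
  shows "2 * card T + n = n * n"
proof -
  have sub: "T \<subseteq> {1..n} \<times> {1..n}" and irr: "\<And>i. (i, i) \<notin> T"
    and total: "\<And>i j. i \<in> {1..n} \<Longrightarrow> j \<in> {1..n} \<Longrightarrow> i \<noteq> j \<Longrightarrow> (i, j) \<in> T \<longleftrightarrow> (j, i) \<notin> T"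
    using T unfolding tournaments_def irrefl_def by blast+
  have U: "T \<union> T\<inverse> \<union> Id_on {1..n} = {1..n} \<times> {1..n}"
    using sub total by blast
  have D: "T \<inter> T\<inverse> = {}" "(T \<union> T\<inverse>) \<inter> Id_on {1..n} = {}"
    using sub irr total by blast+
  have fin: "finite T" "finite (T\<inverse>)"
    using tournament_finite[OF T] by auto
  have Id: "Id_on {1..n} = (\<lambda>i. (i, i)) ` {1..n}"
    by (auto simp: Id_on_def)
  have "card (Id_on {1..n}) = n"
    unfolding Id by (subst card_image) (auto simp: inj_on_def)
  moreover have "finite (Id_on {1..n})"
    unfolding Id by simp
  ultimately have "card (T \<union> T\<inverse> \<union> Id_on {1..n}) = card T + card T + n"
    using fin D by (simp add: card_Un_disjoint)
  then show ?thesis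
    unfolding U by (simp add: card_cartesian_product)
qed

text \<open>Lets \<open>card_tournament\<close> count the matches that the first \<open>k\<close>
  teams play among themselves.\<close>

lemma tournament_restrict:
  assumes "T \<in> tournaments n" "k \<le> n"
  shows "T \<inter> {1..k} \<times> {1..k} \<in> tournaments k"
proof -
  have "{1..k} \<subseteq> {1..n}"
    using assms(2) by simp
  then show ?thesis
    using assms(1) unfolding tournaments_def irrefl_def by blast
qed

lemma sum_wins:
  assumes "finite T" "finite A"
  shows "(\<Sum>i\<in>A. wins T i) = card (T \<inter> A \<times> UNIV)"
proof -
  have "finite {j. (i, j) \<in> T}" for i
    by (rule finite_subset[OF _ finite_imageI[OF assms(1), of snd]]) force
  then have "(\<Sum>i\<in>A. wins T i) = card (SIGMA i:A. {j. (i, j) \<in> T})"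
    using assms by (simp add: wins_def)
  also have "(SIGMA i:A. {j. (i, j) \<in> T}) = T \<inter> A \<times> UNIV"
    by auto
  finally show ?thesis .
qed

lemma sum_real_pred: "(\<Sum>i=1..k. real i - 1) = real k * (real k - 1) / 2"
  by (induction k) (auto simp: field_simps)

lemma sum_wins_ge:
  assumes T: "T \<in> tournaments n" and "k \<le> n"
  shows "(\<Sum>i=1..k. real i - 1) \<le> (\<Sum>i=1..k. real (wins T i))"
proof -
  have "real (2 * card (T \<inter> {1..k} \<times> {1..k}) + k) = real (k * k)"
    using card_tournament[OF tournament_restrict[OF assms]] by presburger
  \<comment> \<open>Wins of the first \<open>k\<close> teams against teams beyond \<open>k\<close>
    can only add to the count.\<close>
  moreover have "card (T \<inter> {1..k} \<times> {1..k}) \<le> card (T \<inter> {1..k} \<times> UNIV)"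
    using tournament_finite[OF T] by (intro card_mono) auto
  moreover have "(\<Sum>i=1..k. real (wins T i)) = real (card (T \<inter> {1..k} \<times> UNIV))"
    using sum_wins[of T "{1..k}"] tournament_finite[OF T] by (simp flip: of_nat_sum)
  ultimately show ?thesis
    unfolding sum_real_pred by (simp add: algebra_simps)
qed

lemma sum_wins_eq:
  assumes T: "T \<in> tournaments n"
  shows "(\<Sum>i=1..n. real (wins T i)) = (\<Sum>i=1..n. real i - 1)"
proof -
  have "T \<inter> {1..n} \<times> UNIV = T"
    using T by (auto simp: tournaments_def)
  then have "(\<Sum>i=1..n. real (wins T i)) = real (card T)"
    using sum_wins[of T "{1..n}"] tournament_finite[OF T] by (simp flip: of_nat_sum)
  moreover have "real (2 * card T + n) = real (n * n)"
    using card_tournament[OF T] by presburger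
  ultimately show ?thesis
    unfolding sum_real_pred by (simp add: algebra_simps)
qed

section \<open>Expectations over random tournaments, and necessity\<close>

lemma integrable_random_tournament:
  fixes f :: "(nat \<times> nat) set \<Rightarrow> real"
  assumes "random_tournament n \<mu>"
  shows "integrable (measure_pmf \<mu>) f"
  using assms finite_tournaments[of n]
  by (intro integrable_measure_pmf_finite) (auto simp: random_tournament_def intro: finite_subset)

lemma sum_mean_score:
  assumes "random_tournament n \<mu>"
  shows "(\<Sum>i\<in>A. mean_score \<mu> i) = measure_pmf.expectation \<mu> (\<lambda>T. \<Sum>i\<in>A. real (wins T i))"
  unfolding mean_score_def
  by (rule Bochner_Integration.integral_sum[symmetric]) (rule integrable_random_tournament[OF assms])

text \<open>Summing over the fixed set \<open>tournaments n\<close> instead of the support of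
  \<open>\<mu>\<close> lets the sums for different distributions be combined term by term in
  \<open>score_sequences_convex\<close>.\<close>

lemma mean_score_eq_sum:
  assumes "random_tournament n \<mu>"
  shows "mean_score \<mu> i = (\<Sum>T\<in>tournaments n. pmf \<mu> T * real (wins T i))"
  using assms unfolding mean_score_def random_tournament_def
  by (subst integral_measure_pmf_real[OF finite_tournaments[of n]])
     (auto simp: mult.commute intro!: sum.cong)

text \<open>Every tournament in the support satisfies the partial sum conditions, and expectation is
  linear and monotone.\<close>

lemma majorized_mean_score:
  assumes \<mu>: "random_tournament n \<mu>" and x: "mean_score_sequence n \<mu> x"
  shows "majorized_by n x (\<lambda>i. real i - 1)"
proof -
  have x_sum: "(\<Sum>i=1..k. x i) = measure_pmf.expectation \<mu> (\<lambda>T. \<Sum>i=1..k. real (wins T i))"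
    if "k \<le> n" for k
    using that x sum_mean_score[OF \<mu>, of "{1..k}"] by (simp add: mean_score_sequence_def)
  have T: "AE T in measure_pmf \<mu>. T \<in> tournaments n"
    using \<mu> by (auto simp: AE_measure_pmf_iff random_tournament_def)
  have "(\<Sum>i=1..k. real i - 1) \<le> (\<Sum>i=1..k. x i)" if "k \<le> n" for k
  proof -
    have "AE T in measure_pmf \<mu>. (\<Sum>i=1..k. real i - 1) \<le> (\<Sum>i=1..k. real (wins T i))"
      using T by eventually_elim (rule sum_wins_ge[OF _ that])
    then have "measure_pmf.expectation \<mu> (\<lambda>_. \<Sum>i=1..k. real i - 1)
        \<le> measure_pmf.expectation \<mu> (\<lambda>T. \<Sum>i=1..k. real (wins T i))"
      by (intro integral_mono_AE integrable_random_tournament[OF \<mu>])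
    then show ?thesis
      unfolding x_sum[OF that] by simp
  qed
  moreover have "(\<Sum>i=1..n. x i) = (\<Sum>i=1..n. real i - 1)"
  proof -
    have "measure_pmf.expectation \<mu> (\<lambda>T. \<Sum>i=1..n. real (wins T i))
        = measure_pmf.expectation \<mu> (\<lambda>_. \<Sum>i=1..n. real i - 1)"
      using T by (intro integral_cong_AE eventually_mono[OF T] sum_wins_eq) auto
    then show ?thesis
      unfolding x_sum[OF order_refl] by simp
  qed
  ultimately show ?thesis
    by (simp add: majorized_by_def)
qed

section \<open>Closure properties of the set of mean score sequences\<close>

definition score_sequences :: "nat \<Rightarrow> (nat \<Rightarrow> real) set" where
  "score_sequences n = {x. \<exists>\<mu>. random_tournament n \<mu> \<and> mean_score_sequence n \<mu> x}"

lemma score_sequences_transitive: "(\<lambda>i. real i - 1) \<in> score_sequences n"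
proof -
  \<comment> \<open>The transitive tournament: the team with the higher number always wins, so team
    \<open>i\<close> beats exactly the \<open>i - 1\<close> teams before it.\<close>
  define T where "T = {(i, j). i \<in> {1..n} \<and> j \<in> {1..<i}}"
  have "T \<in> tournaments n"
    by (auto simp: T_def tournaments_def irrefl_def)
  then have "random_tournament n (return_pmf T)"
    by (simp add: random_tournament_def)
  moreover have "real (wins T i) = real i - 1" if "i \<in> {1..n}" for i
  proof -
    have "{j. (i, j) \<in> T} = {1..<i}"
      using that by (auto simp: T_def)
    then show ?thesis
      using that by (simp add: wins_def of_nat_diff)
  qed
  then have "mean_score_sequence n (return_pmf T) (\<lambda>i. real i - 1)"
    by (simp add: mean_score_sequence_def mean_score_def)
  ultimately show ?thesis
    unfolding score_sequences_def by blast
qed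

lemma score_sequences_convex:
  assumes "x \<in> score_sequences n" "y \<in> score_sequences n" "p \<in> {0..1}"
  shows "(\<lambda>i. p * x i + (1 - p) * y i) \<in> score_sequences n"
proof -
  obtain \<mu> \<nu> where \<mu>: "random_tournament n \<mu>" "mean_score_sequence n \<mu> x"
    and \<nu>: "random_tournament n \<nu>" "mean_score_sequence n \<nu> y"
    using assms by (auto simp: score_sequences_def)
  \<comment> \<open>Flip a coin of bias \<open>p\<close> to decide whether to sample from
    \<open>\<mu>\<close> or from \<open>\<nu>\<close>.\<close>
  let ?\<rho> = "bernoulli_pmf p \<bind> (\<lambda>b. if b then \<mu> else \<nu>)"
  have \<rho>: "random_tournament n ?\<rho>"
    using \<mu>(1) \<nu>(1) by (auto simp: random_tournament_def split: if_splits)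
  have "pmf ?\<rho> T = p * pmf \<mu> T + (1 - p) * pmf \<nu> T" for T
    using assms(3) by (simp add: pmf_bind)
  then have "mean_score ?\<rho> i = p * mean_score \<mu> i + (1 - p) * mean_score \<nu> i" for i
    unfolding mean_score_eq_sum[OF \<rho>] mean_score_eq_sum[OF \<mu>(1)] mean_score_eq_sum[OF \<nu>(1)]
    by (simp add: sum.distrib sum_distrib_left distrib_right mult.assoc)
  then have "mean_score_sequence n ?\<rho> (\<lambda>i. p * x i + (1 - p) * y i)"
    using \<mu>(2) \<nu>(2) by (simp add: mean_score_sequence_def)
  then show ?thesis
    using \<rho> unfolding score_sequences_def by blast
qed

lemma score_sequences_permute:
  assumes x: "x \<in> score_sequences n" and \<pi>: "\<pi> permutes {1..n}"
  shows "x \<circ> \<pi> \<in> score_sequences n"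
proof -
  obtain \<mu> where \<mu>: "random_tournament n \<mu>" "mean_score_sequence n \<mu> x"
    using x by (auto simp: score_sequences_def)
  \<comment> \<open>Team \<open>i\<close> takes over the results of team
    \<open>\<pi> i\<close>.\<close>
  define relabel where "relabel T = {(i, j). (\<pi> i, \<pi> j) \<in> T}" for T :: "(nat \<times> nat) set"
  have range: "\<pi> i \<in> {1..n} \<longleftrightarrow> i \<in> {1..n}" for i
    using permutes_in_image[OF \<pi>] .
  have inj: "\<pi> i = \<pi> j \<longleftrightarrow> i = j" for i j
    using permutes_inj[OF \<pi>] by (auto dest: injD)
  have "relabel T \<in> tournaments n" if T: "T \<in> tournaments n" for T
  proof -
    have "relabel T \<subseteq> {1..n} \<times> {1..n}"
      using T range unfolding relabel_def tournaments_def by blast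
    moreover have "irrefl (relabel T)"
      using T by (auto simp: relabel_def tournaments_def irrefl_def)
    moreover have "(i, j) \<in> relabel T \<longleftrightarrow> (j, i) \<notin> relabel T"
      if "i \<in> {1..n}" "j \<in> {1..n}" "i \<noteq> j" for i j
    proof -
      have "\<pi> i \<in> {1..n}" "\<pi> j \<in> {1..n}" "\<pi> i \<noteq> \<pi> j"
        using that range inj by blast+
      then show ?thesis
        using T unfolding relabel_def tournaments_def by blast
    qed
    ultimately show ?thesis
      unfolding tournaments_def by blast
  qed
  then have "random_tournament n (map_pmf relabel \<mu>)"
    using \<mu>(1) by (auto simp: random_tournament_def)
  moreover have "wins (relabel T) i = wins T (\<pi> i)" for T i
  proof -
    have "{j. (\<pi> i, j) \<in> T} = \<pi> ` {j. (i, j) \<in> relabel T}"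
      using permutes_surj[OF \<pi>] by (auto simp: relabel_def image_iff surj_def)
    then show ?thesis
      using card_image[of \<pi>] permutes_inj[OF \<pi>] unfolding wins_def
      by (metis inj_on_subset subset_UNIV)
  qed
  then have "mean_score (map_pmf relabel \<mu>) i = mean_score \<mu> (\<pi> i)" for i
    by (simp add: mean_score_def)
  then have "mean_score_sequence n (map_pmf relabel \<mu>) (x \<circ> \<pi>)"
    using \<mu>(2) range by (simp add: mean_score_sequence_def)
  ultimately show ?thesis
    unfolding score_sequences_def by blast
qed

section \<open>Sufficiency by Robin Hood transfers\<close>

lemma score_sequences_transfer:
  assumes y: "y \<in> score_sequences n" and jk: "j \<in> {1..n}" "k \<in> {1..n}"
    and d: "0 \<le> d" "d < y k - y j"
  shows "y(j := y j + d, k := y k - d) \<in> score_sequences n"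
proof -
  \<comment> \<open>Mixing \<open>y\<close> with its copy in which entries \<open>j\<close> and
    \<open>k\<close> are swapped moves these two towards each other by
    \<open>(1 - p) * (y k - y j)\<close> and fixes the rest; \<open>p\<close> is chosen to make this
    amount \<open>d\<close>.\<close>
  define p where "p = 1 - d / (y k - y j)"
  have p: "p \<in> {0..1}" "(1 - p) * (y k - y j) = d"
    using d by (auto simp: p_def field_simps)
  have "y(j := y j + d, k := y k - d) = (\<lambda>i. p * y i + (1 - p) * (y \<circ> Transposition.transpose j k) i)"
    unfolding p(2)[symmetric] by (auto simp: fun_eq_iff Transposition.transpose_def algebra_simps)
  moreover have "y \<circ> Transposition.transpose j k \<in> score_sequences n"
    using jk by (intro score_sequences_permute[OF y] permutes_swap_id)
  ultimately show ?thesis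
    using score_sequences_convex[OF y _ p(1)] by metis
qed

text \<open>Induction on the number of entries where \<open>y\<close> and \<open>x\<close> differ.
  The intermediate sequences \<open>y\<close> may fail to be non-decreasing;
  \<open>majorized_by\<close> then just compares partial sums in index order.\<close>

lemma majorized_imp_score_sequence:
  assumes mono: "mono_on {1..n} x" and "y \<in> score_sequences n" and "majorized_by n x y"
  shows "x \<in> score_sequences n"
  using assms(2,3)
proof (induction "card {i \<in> {1..n}. y i \<noteq> x i}" arbitrary: y rule: less_induct)
  case less
  show ?case
  proof (cases "\<forall>i\<in>{1..n}. y i = x i")
    case True
    \<comment> \<open>\<open>mean_score_sequence\<close> looks only at the values on
      \<open>{1..n}\<close>.\<close>
    then show ?thesis
      using less.prems(1) by (auto simp: score_sequences_def mean_score_sequence_def)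
  next
    case False
    have partial: "(\<Sum>i=1..m. y i) \<le> (\<Sum>i=1..m. x i)" if "m \<in> {1..n}" for m
      using that less.prems(2) by (auto simp: majorized_by_def)
    have total: "(\<Sum>i=1..n. x i) = (\<Sum>i=1..n. y i)"
      using less.prems(2) by (auto simp: majorized_by_def)
    \<comment> \<open>The totals agree, so a disagreement forces some entry of \<open>y\<close> to
      be too large.\<close>
    have ex_k: "\<exists>k. k \<in> {1..n} \<and> x k < y k"
    proof (rule ccontr)
      assume "\<not> ?thesis"
      then have "\<forall>i\<in>{1..n}. y i \<le> x i"
        by force
      then have "(\<Sum>i=1..n. y i) < (\<Sum>i=1..n. x i)"
        using False by (intro sum_strict_mono_ex1) force+
      then show False
        using total by simp
    qed
    \<comment> \<open>Taking the first entry that is too large ensures \<open>y i \<le> x i\<close>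
      at all earlier ones.\<close>
    define k where "k = (LEAST k. k \<in> {1..n} \<and> x k < y k)"
    have k: "k \<in> {1..n}" "x k < y k"
      using LeastI_ex[OF ex_k] by (auto simp: k_def)
    have below: "y i \<le> x i" if "i \<in> {1..<k}" for i
      using not_less_Least[of i "\<lambda>k. k \<in> {1..n} \<and> x k < y k"] that k(1) by (auto simp: k_def)
    \<comment> \<open>Otherwise \<open>y\<close> would have the larger partial sum up to
      \<open>k\<close>.\<close>
    obtain j where j: "j \<in> {1..<k}" "y j < x j"
    proof (rule ccontr)
      assume "\<not> thesis"
      then have "\<forall>i\<in>{1..<k}. x i \<le> y i"
        using that by force
      then have "(\<Sum>i=1..k. x i) < (\<Sum>i=1..k. y i)"
        using k by (intro sum_strict_mono_ex1) (auto simp: order_le_less)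
      then show False
        using partial[OF k(1)] by simp
    qed
    \<comment> \<open>The largest transfer that overshoots neither target; it makes entry
      \<open>j\<close> or entry \<open>k\<close> agree with \<open>x\<close>.\<close>
    define d where "d = min (x j - y j) (y k - x k)"
    have d: "0 < d" "d \<le> x j - y j" "d \<le> y k - x k"
      using j k by (auto simp: d_def)
    have jn: "j \<in> {1..n}" "j < k"
      using j(1) k(1) by auto
    \<comment> \<open>Monotonicity of \<open>x\<close> gives
      \<open>y j < x j \<le> x k < y k\<close>, hence \<open>d < y k - y j\<close> as the transfer
      requires.\<close>
    have "x j \<le> x k"
      using jn k(1) by (intro mono_onD[OF mono]) auto
    define z where "z = y(j := y j + d, k := y k - d)"
    have "z \<in> score_sequences n"
      unfolding z_def using less.prems(1) jn(1) k(1) d \<open>x j \<le> x k\<close> j(2) k(2)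
      by (intro score_sequences_transfer) auto
    moreover have "majorized_by n x z"
    proof -
      have z: "z i = y i + (if i = j then d else 0) - (if i = k then d else 0)" for i
        using jn(2) by (auto simp: z_def)
      have sum_z: "(\<Sum>i=1..m. z i)
          = (\<Sum>i=1..m. y i) + (if j \<le> m then d else 0) - (if k \<le> m then d else 0)" for m
        using jn(1) k(1) by (simp add: z sum.distrib sum_subtractf)
      have "(\<Sum>i=1..m. z i) \<le> (\<Sum>i=1..m. x i)" if m: "m \<in> {1..n}" for m
      \<comment> \<open>Only these partial sums change, growing by \<open>d\<close>. Up to such an
        \<open>m\<close> every \<open>x i - y i\<close> is nonnegative, so the slack is at least
        \<open>x j - y j\<close>, which is at least \<open>d\<close>.\<close>
      proof (cases "j \<le> m \<and> m < k")
        case True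
        have "x j - y j \<le> (\<Sum>i=1..m. x i - y i)"
          using True jn below by (intro member_le_sum) auto
        then show ?thesis
          using True d(2) unfolding sum_z by (simp add: sum_subtractf)
      next
        case False
        then show ?thesis
          using partial[OF m] jn(2) unfolding sum_z by auto
      qed
      moreover have "(\<Sum>i=1..n. x i) = (\<Sum>i=1..n. z i)"
        unfolding sum_z using total jn k(1) by simp
      ultimately show ?thesis
        by (auto simp: majorized_by_def)
    qed
    moreover have "card {i \<in> {1..n}. z i \<noteq> x i} < card {i \<in> {1..n}. y i \<noteq> x i}"
    proof (rule psubset_card_mono)
      have "z j = x j \<or> z k = x k"
        using jn(2) by (auto simp: z_def d_def min_def)
      moreover have "y j \<noteq> x j" "y k \<noteq> x k"
        using j(2) k(2) by simp_all
      \<comment> \<open>The transfer changes only entries \<open>j\<close> and \<open>k\<close>,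
        which both disagreed before.\<close>
      moreover have "{i \<in> {1..n}. z i \<noteq> x i} \<subseteq> {i \<in> {1..n}. y i \<noteq> x i}"
      proof
        fix i assume "i \<in> {i \<in> {1..n}. z i \<noteq> x i}"
        moreover have "z i = y i" if "i \<noteq> j" "i \<noteq> k"
          using that by (simp add: z_def)
        ultimately show "i \<in> {i \<in> {1..n}. y i \<noteq> x i}"
          using \<open>y j \<noteq> x j\<close> \<open>y k \<noteq> x k\<close> by (cases "i = j \<or> i = k") auto
      qed
      ultimately show "{i \<in> {1..n}. z i \<noteq> x i} \<subset> {i \<in> {1..n}. y i \<noteq> x i}"
        using jn(1) k(1) by blast
    qed simp
    ultimately show ?thesis
      by (intro less.hyps)
  qed
qed

theorem theorem2:
  fixes n :: nat and x :: "nat \<Rightarrow> real"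
  assumes "n \<ge> 1"
    and "mono_on {1..n} x"
  shows "(\<exists>\<mu>. random_tournament n \<mu> \<and> mean_score_sequence n \<mu> x) \<longleftrightarrow>
         majorized_by n x (\<lambda>i. real i - 1)"
proof
  assume "\<exists>\<mu>. random_tournament n \<mu> \<and> mean_score_sequence n \<mu> x"
  then show "majorized_by n x (\<lambda>i. real i - 1)"
    using majorized_mean_score by blast
next
  assume "majorized_by n x (\<lambda>i. real i - 1)"
  then have "x \<in> score_sequences n"
    by (rule majorized_imp_score_sequence[OF assms(2) score_sequences_transitive])
  then show "\<exists>\<mu>. random_tournament n \<mu> \<and> mean_score_sequence n \<mu> x"
    unfolding score_sequences_def by blast
qed

end
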